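(* Let $G$ be a $G$-formula and let $\Gamma$ be a finite multiset of $D$-formulas. Then $\Gamma \vdash_C G$ if and only if $G\supset\bot,\Gamma\vdash_O G$.
   Context: Formulas are those of a first-order language with logical symbols $\top,\bot,\land,\lor,\supset,\exists,\forall$; $\top$ and $\bot$ are not atomic. $[t/x]B$ is capture-avoiding substitution. A sequent $\Gamma\longrightarrow\Delta$ is a pair of finite multisets of formulas; $B,\Gamma$ denotes $\Gamma$ with one extra occurrence of $B$. A sequent is an axiom if $\top\in\Delta$, or some $A$ that is $\bot$ or atomic lies in both $\Gamma$ and $\Delta$. Inference rules (upper sequents $\Rightarrow$ lower sequent): contr-L: $B,B,\Gamma\longrightarrow\Delta \Rightarrow B,\Gamma\longrightarrow\Delta$; contr-R: $\Gamma\longrightarrow\Delta,B,B\Rightarrow\Gamma\longrightarrow\Delta,B$; $\bot$-R: $\Gamma\longrightarrow\Delta,\bot\Rightarrow\Gamma\longrightarrow\Delta,D$; $\land$-L: $B,D,B\land D,\Gamma\longrightarrow\Delta\Rightarrow B\land D,\Gamma\longrightarrow\Delta$; $\land$-R: $\Gamma\longrightarrow\Delta,B$ and $\Gamma\longrightarrow\Delta,D\Rightarrow\Gamma\longrightarrow\Delta,B\land D$; $\lor$-L: $B,\Gamma\longrightarrow\Delta$ and $D,\Gamma\longrightarrow\Delta\Rightarrow B\lor D,\Gamma\longrightarrow\Delta$; $\lor$-R: $\Gamma\longrightarrow\Delta,B$ (or $\Gamma\longrightarrow\Delta,D$) $\Rightarrow\Gamma\longrightarrow\Delta,B\lor D$;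 $\supset$-L: $B\supset D,\Gamma\longrightarrow B,\Delta$ and $D,\Gamma\longrightarrow\Theta\Rightarrow B\supset D,\Gamma\longrightarrow\Delta,\Theta$; $\supset$-R: $B,\Gamma\longrightarrow\Delta,D\Rightarrow\Gamma\longrightarrow\Delta,B\supset D$; $\forall$-L: $[t/x]B,\forall x B,\Gamma\longrightarrow\Delta\Rightarrow\forall xB,\Gamma\longrightarrow\Delta$; $\exists$-R: $\Gamma\longrightarrow\Delta,[t/x]B\Rightarrow\Gamma\longrightarrow\Delta,\exists xB$ ($t$ any term); $\exists$-L: $[c/x]B,\Gamma\longrightarrow\Delta\Rightarrow\exists xB,\Gamma\longrightarrow\Delta$ and $\forall$-R: $\Gamma\longrightarrow\Delta,[c/x]B\Rightarrow\Gamma\longrightarrow\Delta,\forall xB$, where the constant $c$ does not occur in the lower sequent. A C-proof is a finite derivation tree using these rules with axioms at the leaves; $\Gamma\vdash_C B$ means $\Gamma\longrightarrow B$ has a C-proof. An I-proof is a C-proof in which every sequent has exactly one succedent formula. A uniform proof is an I-proof in which every sequent whose succedent formula has a top-level connective or quantifier among $\land,\lor,\supset,\exists,\forall$ occurs only as the lower sequent of the inference rule introducing that top-level symbol; $\Gamma\vdash_O B$ means $\Gamma\longrightarrow B$ has a uniform proof. $G$-formulas and $D$-formulas: $G ::= \top \mid \bot \mid A \mid G\land G \mid G\lor G \mid D\supset G \mid \exists x\, G$ and $D ::= \top \mid \bot \mid A \mid G\supset D \mid D\land D \mid D\lor D \mid \exists x\, D \mid \forall x\, D$, $A$ atomic.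
   Formalization: The first-order language is assumed to have infinitely many constants, so that a constant not occurring in the lower sequent is always available for the ∃-L and ∀-R rules; with only one constant the stated equivalence can fail. *)

theory Defs
  imports "HOL-Library.Multiset"
begin

text \<open>
  A language is given by the arities of its function and predicate symbols; constants are the
  nullary function symbols. Formulas are in de Bruijn notation, so that they are identified up to
  renaming of bound variables. Dangling indices are the free variables: formulas need not be closed.
\<close>

record ('f, 'p) language =
  fun_arity :: "'f \<Rightarrow> nat"
  pred_arity :: "'p \<Rightarrow> nat"

definition constants :: "('f, 'p) language \<Rightarrow> 'f set" where
  "constants L = {c. fun_arity L c = 0}"

datatype (fun_syms_tm: 'f) tm = Var nat | Fun 'f "'f tm list"

datatype (fun_syms: 'f, pred_syms: 'p) fm =
    Top
  | Bot
  | Atom 'p "'f tm list"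
  | Con "('f, 'p) fm" "('f, 'p) fm"
  | Dis "('f, 'p) fm" "('f, 'p) fm"
  | Imp "('f, 'p) fm" "('f, 'p) fm"
  | Ex "('f, 'p) fm"
  | All "('f, 'p) fm"

primrec wf_tm :: "('f, 'p) language \<Rightarrow> 'f tm \<Rightarrow> bool" where
  "wf_tm L (Var n) \<longleftrightarrow> True"
| "wf_tm L (Fun f ts) \<longleftrightarrow> length ts = fun_arity L f \<and> list_all (wf_tm L) ts"

primrec wf_fm :: "('f, 'p) language \<Rightarrow> ('f, 'p) fm \<Rightarrow> bool" where
  "wf_fm L Top \<longleftrightarrow> True"
| "wf_fm L Bot \<longleftrightarrow> True"
| "wf_fm L (Atom p ts) \<longleftrightarrow> length ts = pred_arity L p \<and> list_all (wf_tm L) ts"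
| "wf_fm L (Con B D) \<longleftrightarrow> wf_fm L B \<and> wf_fm L D"
| "wf_fm L (Dis B D) \<longleftrightarrow> wf_fm L B \<and> wf_fm L D"
| "wf_fm L (Imp B D) \<longleftrightarrow> wf_fm L B \<and> wf_fm L D"
| "wf_fm L (Ex B) \<longleftrightarrow> wf_fm L B"
| "wf_fm L (All B) \<longleftrightarrow> wf_fm L B"

primrec lift_tm :: "'f tm \<Rightarrow> 'f tm" where
  "lift_tm (Var n) = Var (Suc n)"
| "lift_tm (Fun f ts) = Fun f (map lift_tm ts)"

text \<open>
  Substitution for index \<open>k\<close> removes the binder of \<open>k\<close>, hence the indices above \<open>k\<close> are decremented.
  With \<open>B\<close> the body of a quantified formula, \<open>subst_fm 0 t B\<close> is $[t/x]B$.
\<close>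

primrec subst_tm :: "nat \<Rightarrow> 'f tm \<Rightarrow> 'f tm \<Rightarrow> 'f tm" where
  "subst_tm k t (Var n) = (if n < k then Var n else if n = k then t else Var (n - 1))"
| "subst_tm k t (Fun f ts) = Fun f (map (subst_tm k t) ts)"

primrec subst_fm :: "nat \<Rightarrow> 'f tm \<Rightarrow> ('f, 'p) fm \<Rightarrow> ('f, 'p) fm" where
  "subst_fm k t Top = Top"
| "subst_fm k t Bot = Bot"
| "subst_fm k t (Atom p ts) = Atom p (map (subst_tm k t) ts)"
| "subst_fm k t (Con B D) = Con (subst_fm k t B) (subst_fm k t D)"
| "subst_fm k t (Dis B D) = Dis (subst_fm k t B) (subst_fm k t D)"
| "subst_fm k t (Imp B D) = Imp (subst_fm k t B) (subst_fm k t D)"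
| "subst_fm k t (Ex B) = Ex (subst_fm (Suc k) (lift_tm t) B)"
| "subst_fm k t (All B) = All (subst_fm (Suc k) (lift_tm t) B)"

abbreviation inst :: "('f, 'p) fm \<Rightarrow> 'f tm \<Rightarrow> ('f, 'p) fm" where
  "inst B t \<equiv> subst_fm 0 t B"

abbreviation Const :: "'f \<Rightarrow> 'f tm" where
  "Const c \<equiv> Fun c []"

type_synonym ('f, 'p) sequent = "('f, 'p) fm multiset \<times> ('f, 'p) fm multiset"

abbreviation Seq :: "('f, 'p) fm multiset \<Rightarrow> ('f, 'p) fm multiset \<Rightarrow> ('f, 'p) sequent"
    (infix "\<turnstile>" 45) where
  "\<Gamma> \<turnstile> \<Delta> \<equiv> (\<Gamma>, \<Delta>)"

fun fun_syms_seq :: "('f, 'p) sequent \<Rightarrow> 'f set" where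
  "fun_syms_seq (\<Gamma> \<turnstile> \<Delta>) = (\<Union>B \<in> set_mset (\<Gamma> + \<Delta>). fun_syms B)"

fun is_axiom :: "('f, 'p) sequent \<Rightarrow> bool" where
  "is_axiom (\<Gamma> \<turnstile> \<Delta>) \<longleftrightarrow>
     Top \<in># \<Delta> \<or> (\<exists>A. A \<in># \<Gamma> \<and> A \<in># \<Delta> \<and> (A = Bot \<or> (\<exists>p ts. A = Atom p ts)))"

datatype rule =
  ContrL | ContrR | BotR | ConL | ConR | DisL | DisR | ImpL | ImpR | AllL | AllR | ExL | ExR

text \<open>
  \<open>inference L r us s\<close>: from the upper sequents \<open>us\<close>, rule \<open>r\<close> infers the lower sequent \<open>s\<close>.
  Read upwards, the rules only produce instances of subformulas of the lower sequent, so it is enough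
  to require well-formedness of the instantiating terms: a derivation of a sequent of well-formed
  formulas consists of such sequents only.
\<close>

inductive inference ::
  "('f, 'p) language \<Rightarrow> rule \<Rightarrow> ('f, 'p) sequent list \<Rightarrow> ('f, 'p) sequent \<Rightarrow> bool"
  for L :: "('f, 'p) language" where
  contrL: "inference L ContrL
     [add_mset B (add_mset B \<Gamma>) \<turnstile> \<Delta>]
     (add_mset B \<Gamma> \<turnstile> \<Delta>)"
| contrR: "inference L ContrR
     [\<Gamma> \<turnstile> add_mset B (add_mset B \<Delta>)]
     (\<Gamma> \<turnstile> add_mset B \<Delta>)"
| botR: "inference L BotR
     [\<Gamma> \<turnstile> add_mset Bot \<Delta>]
     (\<Gamma> \<turnstile> add_mset D \<Delta>)"
| conL: "inference L ConL
     [add_mset B (add_mset D (add_mset (Con B D) \<Gamma>)) \<turnstile> \<Delta>]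
     (add_mset (Con B D) \<Gamma> \<turnstile> \<Delta>)"
| conR: "inference L ConR
     [\<Gamma> \<turnstile> add_mset B \<Delta>, \<Gamma> \<turnstile> add_mset D \<Delta>]
     (\<Gamma> \<turnstile> add_mset (Con B D) \<Delta>)"
| disL: "inference L DisL
     [add_mset B \<Gamma> \<turnstile> \<Delta>, add_mset D \<Gamma> \<turnstile> \<Delta>]
     (add_mset (Dis B D) \<Gamma> \<turnstile> \<Delta>)"
| disR1: "inference L DisR
     [\<Gamma> \<turnstile> add_mset B \<Delta>]
     (\<Gamma> \<turnstile> add_mset (Dis B D) \<Delta>)"
| disR2: "inference L DisR
     [\<Gamma> \<turnstile> add_mset D \<Delta>]
     (\<Gamma> \<turnstile> add_mset (Dis B D) \<Delta>)"
| impL: "inference L ImpL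
     [add_mset (Imp B D) \<Gamma> \<turnstile> add_mset B \<Delta>, add_mset D \<Gamma> \<turnstile> \<Theta>]
     (add_mset (Imp B D) \<Gamma> \<turnstile> \<Delta> + \<Theta>)"
| impR: "inference L ImpR
     [add_mset B \<Gamma> \<turnstile> add_mset D \<Delta>]
     (\<Gamma> \<turnstile> add_mset (Imp B D) \<Delta>)"
| allL: "wf_tm L t \<Longrightarrow> inference L AllL
     [add_mset (inst B t) (add_mset (All B) \<Gamma>) \<turnstile> \<Delta>]
     (add_mset (All B) \<Gamma> \<turnstile> \<Delta>)"
| exR: "wf_tm L t \<Longrightarrow> inference L ExR
     [\<Gamma> \<turnstile> add_mset (inst B t) \<Delta>]
     (\<Gamma> \<turnstile> add_mset (Ex B) \<Delta>)"
| exL: "c \<in> constants L \<Longrightarrow> c \<notin> fun_syms_seq (add_mset (Ex B) \<Gamma> \<turnstile> \<Delta>) \<Longrightarrow> inference L ExL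
     [add_mset (inst B (Const c)) \<Gamma> \<turnstile> \<Delta>]
     (add_mset (Ex B) \<Gamma> \<turnstile> \<Delta>)"
| allR: "c \<in> constants L \<Longrightarrow> c \<notin> fun_syms_seq (\<Gamma> \<turnstile> add_mset (All B) \<Delta>) \<Longrightarrow> inference L AllR
     [\<Gamma> \<turnstile> add_mset (inst B (Const c)) \<Delta>]
     (\<Gamma> \<turnstile> add_mset (All B) \<Delta>)"

datatype ('f, 'p) deriv =
    Leaf "('f, 'p) sequent"
  | Infer rule "('f, 'p) deriv list" "('f, 'p) sequent"

primrec endseq :: "('f, 'p) deriv \<Rightarrow> ('f, 'p) sequent" where
  "endseq (Leaf s) = s"
| "endseq (Infer r ds s) = s"

primrec subderivs :: "('f, 'p) deriv \<Rightarrow> ('f, 'p) deriv set" where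
  "subderivs (Leaf s) = {Leaf s}"
| "subderivs (Infer r ds s) = insert (Infer r ds s) (\<Union> (set (map subderivs ds)))"

fun correct_root :: "('f, 'p) language \<Rightarrow> ('f, 'p) deriv \<Rightarrow> bool" where
  "correct_root L (Leaf s) \<longleftrightarrow> is_axiom s"
| "correct_root L (Infer r ds s) \<longleftrightarrow> inference L r (map endseq ds) s"

definition C_proof :: "('f, 'p) language \<Rightarrow> ('f, 'p) deriv \<Rightarrow> bool" where
  "C_proof L d \<longleftrightarrow> (\<forall>e \<in> subderivs d. correct_root L e)"

definition I_proof :: "('f, 'p) language \<Rightarrow> ('f, 'p) deriv \<Rightarrow> bool" where
  "I_proof L d \<longleftrightarrow> C_proof L d \<and> (\<forall>e \<in> subderivs d. size (snd (endseq e)) = 1)"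

fun right_rule :: "('f, 'p) fm \<Rightarrow> rule option" where
  "right_rule (Con B D) = Some ConR"
| "right_rule (Dis B D) = Some DisR"
| "right_rule (Imp B D) = Some ImpR"
| "right_rule (Ex B) = Some ExR"
| "right_rule (All B) = Some AllR"
| "right_rule _ = None"

text \<open>
  In an I-proof the principal formula of a right rule is the only succedent formula, so the rule
  at the root determines which symbol is introduced.
\<close>

definition uniform_root :: "('f, 'p) deriv \<Rightarrow> bool" where
  "uniform_root d \<longleftrightarrow>
     (\<forall>B r. snd (endseq d) = {#B#} \<and> right_rule B = Some r \<longrightarrow> (\<exists>ds s. d = Infer r ds s))"

definition uniform_proof :: "('f, 'p) language \<Rightarrow> ('f, 'p) deriv \<Rightarrow> bool" where
  "uniform_proof L d \<longleftrightarrow> I_proof L d \<and> (\<forall>e \<in> subderivs d. uniform_root e)"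

definition C_provable :: "('f, 'p) language \<Rightarrow> ('f, 'p) fm multiset \<Rightarrow> ('f, 'p) fm \<Rightarrow> bool" where
  "C_provable L \<Gamma> B \<longleftrightarrow> (\<exists>d. C_proof L d \<and> endseq d = (\<Gamma> \<turnstile> {#B#}))"

definition O_provable :: "('f, 'p) language \<Rightarrow> ('f, 'p) fm multiset \<Rightarrow> ('f, 'p) fm \<Rightarrow> bool" where
  "O_provable L \<Gamma> B \<longleftrightarrow> (\<exists>d. uniform_proof L d \<and> endseq d = (\<Gamma> \<turnstile> {#B#}))"

inductive G_formula :: "('f, 'p) fm \<Rightarrow> bool" and D_formula :: "('f, 'p) fm \<Rightarrow> bool" where
  "G_formula Top"
| "G_formula Bot"
| "G_formula (Atom p ts)"
| "G_formula B \<Longrightarrow> G_formula C \<Longrightarrow> G_formula (Con B C)"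
| "G_formula B \<Longrightarrow> G_formula C \<Longrightarrow> G_formula (Dis B C)"
| "D_formula B \<Longrightarrow> G_formula C \<Longrightarrow> G_formula (Imp B C)"
| "G_formula B \<Longrightarrow> G_formula (Ex B)"
| "D_formula Top"
| "D_formula Bot"
| "D_formula (Atom p ts)"
| "G_formula B \<Longrightarrow> D_formula C \<Longrightarrow> D_formula (Imp B C)"
| "D_formula B \<Longrightarrow> D_formula C \<Longrightarrow> D_formula (Con B C)"
| "D_formula B \<Longrightarrow> D_formula C \<Longrightarrow> D_formula (Dis B C)"
| "D_formula B \<Longrightarrow> D_formula (Ex B)"
| "D_formula B \<Longrightarrow> D_formula (All B)"

end

theory Submission
  imports Defs
begin

text \<open>
  Both directions go through a calculus on sets of formulas in which principal formulas persist and
  the eigenvariable rules have one premise for every constant, so that weakening and contraction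
  are built in. The passage to this calculus absorbs all renaming of eigenconstants.

  For the forward direction, sets of formulas containing \<open>G \<supset> \<bottom>\<close> are regarded as worlds of a Kripke
  model ordered by inclusion, in which the uniformly provable goals are forced. Call a goal refuted
  in a world if at every larger world that proves it, \<open>\<bottom>\<close> is provable. By induction on a classical
  proof of \<open>\<Gamma> \<longrightarrow> \<Delta>\<close>, every world containing \<open>\<Gamma>\<close> and refuting all of \<open>\<Delta>\<close> proves \<open>\<bottom>\<close>. In the only
  intuitionistically critical case, \<open>\<supset>\<close>-R, the induction hypothesis makes the world extended by
  the hypothesis of the implication prove \<open>\<bottom>\<close>, hence also its conclusion, because \<open>\<bottom>\<close>-R extends
  from atoms to all \<open>G\<close>-formulas. The assumption \<open>G \<supset> \<bottom>\<close> says precisely that \<open>G\<close> is refuted.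

  For the converse, classically an assumption \<open>H \<supset> \<bottom>\<close> can be dropped if \<open>H\<close> is kept in the succedent.
\<close>

section \<open>Renaming of function symbols\<close>

text \<open>Such renamings may merge symbols, but constants go to constants and instantiating terms
  stay well-formed.\<close>

definition arity_preserving :: "('f, 'p) language \<Rightarrow> ('f \<Rightarrow> 'f) \<Rightarrow> bool" where
  "arity_preserving L \<rho> \<longleftrightarrow> (\<forall>f. fun_arity L (\<rho> f) = fun_arity L f)"

abbreviation rename_fm :: "('f \<Rightarrow> 'f) \<Rightarrow> ('f, 'p) fm \<Rightarrow> ('f, 'p) fm" where
  "rename_fm \<rho> \<equiv> map_fm \<rho> id"

lemma arity_preserving_upd:
  "arity_preserving L \<rho> \<Longrightarrow> c \<in> constants L \<Longrightarrow> c' \<in> constants L \<Longrightarrow> arity_preserving L (\<rho>(c := c'))"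
  by (auto simp: arity_preserving_def constants_def)

lemma wf_rename_tm: "arity_preserving L \<rho> \<Longrightarrow> wf_tm L t \<Longrightarrow> wf_tm L (map_tm \<rho> t)"
  by (induction t) (auto simp: arity_preserving_def list_all_iff)

lemma rename_lift_tm: "map_tm \<rho> (lift_tm t) = lift_tm (map_tm \<rho> t)"
  by (induction t) auto

lemma rename_subst_tm: "map_tm \<rho> (subst_tm k t u) = subst_tm k (map_tm \<rho> t) (map_tm \<rho> u)"
  by (induction u) auto

lemma rename_subst_fm:
  "rename_fm \<rho> (subst_fm k t B) = subst_fm k (map_tm \<rho> t) (rename_fm \<rho> B)"
  by (induction B arbitrary: k t) (auto simp: rename_subst_tm rename_lift_tm)

lemma rename_upd_fresh: "c \<notin> fun_syms B \<Longrightarrow> rename_fm (\<rho>(c := c')) B = rename_fm \<rho> B"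
  by (rule fm.map_cong) auto

text \<open>Freshness of \<open>c\<close> in \<open>B\<close> confines the change of
  \<open>\<rho>\<close> at \<open>c\<close> to the witness. This turns an eigenconstant premise into
  an instance at an arbitrary constant.\<close>

lemma rename_inst_fresh:
  "c \<notin> fun_syms B \<Longrightarrow>
    rename_fm (\<rho>(c := c')) (inst B (Const c)) = inst (rename_fm \<rho> B) (Const c')"
  by (simp add: rename_subst_fm rename_upd_fresh)

lemma finite_fun_syms_tm: "finite (fun_syms_tm t)"
  by (induction t) auto

lemma finite_fun_syms: "finite (fun_syms B)"
  by (induction B) (auto simp: finite_fun_syms_tm)

text \<open>A sequent mentions finitely many symbols; this is how the infinite supply of constants
  provides eigenconstants.\<close>

lemma fresh_constant:
  assumes "infinite (constants L)"
  obtains c where "c \<in> constants L" "c \<notin> fun_syms_seq s"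
proof -
  have "finite (fun_syms_seq s)"
    by (cases s) (auto simp: finite_fun_syms)
  then show ?thesis
    using assms that by (meson infinite_super subsetI)
qed

section \<open>A classical calculus on sets\<close>

inductive cprov :: "('f, 'p) language \<Rightarrow> ('f, 'p) fm set \<Rightarrow> ('f, 'p) fm set \<Rightarrow> bool"
  for L :: "('f, 'p) language" where
  top: "Top \<in> T \<Longrightarrow> cprov L S T"
| ax: "A \<in> S \<Longrightarrow> A \<in> T \<Longrightarrow> A = Bot \<or> (\<exists>p ts. A = Atom p ts) \<Longrightarrow> cprov L S T"
| botR: "D \<in> T \<Longrightarrow> cprov L S (insert Bot T) \<Longrightarrow> cprov L S T"
| conL: "Con B D \<in> S \<Longrightarrow> cprov L (insert B (insert D S)) T \<Longrightarrow> cprov L S T"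
| conR: "Con B D \<in> T \<Longrightarrow> cprov L S (insert B T) \<Longrightarrow> cprov L S (insert D T) \<Longrightarrow> cprov L S T"
| disL: "Dis B D \<in> S \<Longrightarrow> cprov L (insert B S) T \<Longrightarrow> cprov L (insert D S) T \<Longrightarrow> cprov L S T"
| disR1: "Dis B D \<in> T \<Longrightarrow> cprov L S (insert B T) \<Longrightarrow> cprov L S T"
| disR2: "Dis B D \<in> T \<Longrightarrow> cprov L S (insert D T) \<Longrightarrow> cprov L S T"
| impL: "Imp B D \<in> S \<Longrightarrow> cprov L S (insert B T) \<Longrightarrow> cprov L (insert D S) T \<Longrightarrow> cprov L S T"
| impR: "Imp B D \<in> T \<Longrightarrow> cprov L (insert B S) (insert D T) \<Longrightarrow> cprov L S T"
| allL: "All B \<in> S \<Longrightarrow> wf_tm L t \<Longrightarrow> cprov L (insert (inst B t) S) T \<Longrightarrow> cprov L S T"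
| exR: "Ex B \<in> T \<Longrightarrow> wf_tm L t \<Longrightarrow> cprov L S (insert (inst B t) T) \<Longrightarrow> cprov L S T"
| exL: "Ex B \<in> S \<Longrightarrow> (\<And>c. c \<in> constants L \<Longrightarrow> cprov L (insert (inst B (Const c)) S) T) \<Longrightarrow>
    cprov L S T"
| allR: "All B \<in> T \<Longrightarrow> (\<And>c. c \<in> constants L \<Longrightarrow> cprov L S (insert (inst B (Const c)) T)) \<Longrightarrow>
    cprov L S T"

section \<open>Translation of sequent derivations into the set calculus\<close>

text \<open>Rule induction on end sequents, which frees later arguments from derivation
  trees.\<close>

lemma C_proof_induct [consumes 1, case_names axiom inference]:
  assumes "C_proof L d"
    and ax: "\<And>s. is_axiom s \<Longrightarrow> P s"
    and inf: "\<And>r us s. inference L r us s \<Longrightarrow> (\<And>u. u \<in> set us \<Longrightarrow> P u) \<Longrightarrow> P s"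
  shows "P (endseq d)"
  using assms(1)
proof (induction d)
  case (Leaf s)
  then show ?case by (simp add: C_proof_def ax)
next
  case (Infer r ds s)
  then have "inference L r (map endseq ds) s" "\<And>d. d \<in> set ds \<Longrightarrow> P (endseq d)"
    by (auto simp: C_proof_def)
  then show ?case using inf by fastforce
qed

text \<open>
  The second alternative for antecedent formulas serves the converse direction: negations of
  succedent formulas may be omitted.
\<close>

definition embeds ::
  "('f \<Rightarrow> 'f) \<Rightarrow> ('f, 'p) sequent \<Rightarrow> ('f, 'p) fm set \<Rightarrow> ('f, 'p) fm set \<Rightarrow> bool" where
  "embeds \<rho> s S T \<longleftrightarrow>
    (\<forall>F \<in># fst s. rename_fm \<rho> F \<in> S \<or> (\<exists>H \<in> T. rename_fm \<rho> F = Imp H Bot)) \<and>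
    (\<forall>F \<in># snd s. rename_fm \<rho> F \<in> T)"

lemma embeds_add_antecedent:
  "embeds \<rho> (add_mset F \<Gamma> \<turnstile> \<Delta>) S T \<longleftrightarrow>
    (rename_fm \<rho> F \<in> S \<or> (\<exists>H \<in> T. rename_fm \<rho> F = Imp H Bot)) \<and> embeds \<rho> (\<Gamma> \<turnstile> \<Delta>) S T"
  by (auto simp: embeds_def)

lemma embeds_add_succedent:
  "embeds \<rho> (\<Gamma> \<turnstile> add_mset F \<Delta>) S T \<longleftrightarrow> rename_fm \<rho> F \<in> T \<and> embeds \<rho> (\<Gamma> \<turnstile> \<Delta>) S T"
  by (auto simp: embeds_def)

lemma embeds_union_succedent:
  "embeds \<rho> (\<Gamma> \<turnstile> \<Delta> + \<Theta>) S T \<longleftrightarrow> embeds \<rho> (\<Gamma> \<turnstile> \<Delta>) S T \<and> embeds \<rho> (\<Gamma> \<turnstile> \<Theta>) S T"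
  by (auto simp: embeds_def)

lemmas embeds_simps = embeds_add_antecedent embeds_add_succedent embeds_union_succedent

lemma embeds_insert:
  "embeds \<rho> s S T \<Longrightarrow> embeds \<rho> s (insert F S) T"
  "embeds \<rho> s S T \<Longrightarrow> embeds \<rho> s S (insert F T)"
  by (auto simp: embeds_def)

lemma embeds_upd_fresh:
  assumes "c \<notin> fun_syms_seq s"
  shows "embeds (\<rho>(c := c')) s S T \<longleftrightarrow> embeds \<rho> s S T"
proof -
  obtain \<Gamma> \<Delta> where "s = (\<Gamma> \<turnstile> \<Delta>)" by (cases s)
  then show ?thesis
    using assms by (auto simp: embeds_def rename_upd_fresh)
qed

text \<open>The renaming and both sets stay general in the induction: premises embed into sets
  extended by the new formulas, and eigenvariable rules also change the renaming.\<close>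

lemma C_proof_imp_cprov:
  assumes "C_proof L d" and "arity_preserving L \<rho>" and "embeds \<rho> (endseq d) S T"
  shows "cprov L S T"
  using assms
proof (induction arbitrary: \<rho> S T rule: C_proof_induct)
  case (axiom s)
  obtain \<Gamma> \<Delta> where s: "s = (\<Gamma> \<turnstile> \<Delta>)" by (cases s)
  show ?case
  proof (cases "Top \<in># \<Delta>")
    case True
    then have "Top \<in> T"
      using axiom.prems(2) s by (force simp: embeds_def)
    then show ?thesis by (rule cprov.top)
  next
    case False
    then obtain A where A: "A \<in># \<Gamma>" "A \<in># \<Delta>" "A = Bot \<or> (\<exists>p ts. A = Atom p ts)"
      using axiom.hyps s by auto
    \<comment> \<open>The renamed \<open>A\<close> is still \<open>Bot\<close> or atomic, so it is
      not an omitted negation.\<close>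
    then have "rename_fm \<rho> A \<in> S" "rename_fm \<rho> A \<in> T"
      using axiom.prems(2) s by (auto simp: embeds_def)
    then show ?thesis using A(3) by (auto intro: cprov.ax)
  qed
next
  case (inference r us s)
  note IH = inference.IH and ar = inference.prems(1) and em = inference.prems(2)
  from inference.hyps show ?case
  proof cases
    case (contrL B \<Gamma> \<Delta>)
    then show ?thesis
      using em by (intro IH[OF _ ar]) (auto simp: embeds_simps embeds_insert)
  next
    case (contrR \<Gamma> B \<Delta>)
    then show ?thesis
      using em by (intro IH[OF _ ar]) (auto simp: embeds_simps embeds_insert)
  next
    case (botR \<Gamma> \<Delta> D)
    have "cprov L S (insert Bot T)"
      using em botR by (intro IH[OF _ ar]) (auto simp: embeds_simps embeds_insert)
    moreover have "rename_fm \<rho> D \<in> T"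
      using em botR by (auto simp: embeds_simps)
    ultimately show ?thesis by (blast intro: cprov.botR)
  next
    case (conL B D \<Gamma> \<Delta>)
    have "cprov L (insert (rename_fm \<rho> B) (insert (rename_fm \<rho> D) S)) T"
      using em conL by (intro IH[OF _ ar]) (auto simp: embeds_simps embeds_insert)
    moreover have "Con (rename_fm \<rho> B) (rename_fm \<rho> D) \<in> S"
      using em conL by (auto simp: embeds_simps)
    ultimately show ?thesis by (blast intro: cprov.conL)
  next
    case (conR \<Gamma> B \<Delta> D)
    have "cprov L S (insert (rename_fm \<rho> B) T)"
      using em conR
      by (intro IH[of "\<Gamma> \<turnstile> add_mset B \<Delta>", OF _ ar]) (auto simp: embeds_simps embeds_insert)
    moreover have "cprov L S (insert (rename_fm \<rho> D) T)"
      using em conR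
      by (intro IH[of "\<Gamma> \<turnstile> add_mset D \<Delta>", OF _ ar]) (auto simp: embeds_simps embeds_insert)
    moreover have "Con (rename_fm \<rho> B) (rename_fm \<rho> D) \<in> T"
      using em conR by (auto simp: embeds_simps)
    ultimately show ?thesis by (blast intro: cprov.conR)
  next
    case (disL B \<Gamma> \<Delta> D)
    have "cprov L (insert (rename_fm \<rho> B) S) T"
      using em disL
      by (intro IH[of "add_mset B \<Gamma> \<turnstile> \<Delta>", OF _ ar]) (auto simp: embeds_simps embeds_insert)
    moreover have "cprov L (insert (rename_fm \<rho> D) S) T"
      using em disL
      by (intro IH[of "add_mset D \<Gamma> \<turnstile> \<Delta>", OF _ ar]) (auto simp: embeds_simps embeds_insert)
    moreover have "Dis (rename_fm \<rho> B) (rename_fm \<rho> D) \<in> S"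
      using em disL by (auto simp: embeds_simps)
    ultimately show ?thesis by (blast intro: cprov.disL)
  next
    case (disR1 \<Gamma> B \<Delta> D)
    have "cprov L S (insert (rename_fm \<rho> B) T)"
      using em disR1 by (intro IH[OF _ ar]) (auto simp: embeds_simps embeds_insert)
    moreover have "Dis (rename_fm \<rho> B) (rename_fm \<rho> D) \<in> T"
      using em disR1 by (auto simp: embeds_simps)
    ultimately show ?thesis by (blast intro: cprov.disR1)
  next
    case (disR2 \<Gamma> D \<Delta> B)
    have "cprov L S (insert (rename_fm \<rho> D) T)"
      using em disR2 by (intro IH[OF _ ar]) (auto simp: embeds_simps embeds_insert)
    moreover have "Dis (rename_fm \<rho> B) (rename_fm \<rho> D) \<in> T"
      using em disR2 by (auto simp: embeds_simps)
    ultimately show ?thesis by (blast intro: cprov.disR2)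
  next
    case (impL B D \<Gamma> \<Delta> \<Theta>)
    have left: "cprov L S (insert (rename_fm \<rho> B) T)"
      using em impL
      by (intro IH[of "add_mset (Imp B D) \<Gamma> \<turnstile> add_mset B \<Delta>", OF _ ar]) (auto simp: embeds_simps embeds_insert)
    have right: "cprov L (insert (rename_fm \<rho> D) S) T"
      using em impL
      by (intro IH[of "add_mset D \<Gamma> \<turnstile> \<Theta>", OF _ ar]) (auto simp: embeds_simps embeds_insert)
    \<comment> \<open>An omitted implication is \<open>Imp H Bot\<close> with \<open>H\<close> in
      \<open>T\<close>; then the renamed \<open>B\<close> is this \<open>H\<close>, and
      \<open>left\<close> already is the goal.\<close>
    have "Imp (rename_fm \<rho> B) (rename_fm \<rho> D) \<in> S \<or> rename_fm \<rho> B \<in> T"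
      using em impL by (auto simp: embeds_simps)
    then show ?thesis
      using left right by (auto simp: insert_absorb intro: cprov.impL)
  next
    case (impR B \<Gamma> D \<Delta>)
    have "cprov L (insert (rename_fm \<rho> B) S) (insert (rename_fm \<rho> D) T)"
      using em impR by (intro IH[OF _ ar]) (auto simp: embeds_simps embeds_insert)
    moreover have "Imp (rename_fm \<rho> B) (rename_fm \<rho> D) \<in> T"
      using em impR by (auto simp: embeds_simps)
    ultimately show ?thesis by (blast intro: cprov.impR)
  next
    case (allL t B \<Gamma> \<Delta>)
    have "cprov L (insert (inst (rename_fm \<rho> B) (map_tm \<rho> t)) S) T"
      using em allL by (intro IH[OF _ ar]) (auto simp: embeds_simps embeds_insert rename_subst_fm)
    moreover have "All (rename_fm \<rho> B) \<in> S"
      using em allL by (auto simp: embeds_simps)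
    ultimately show ?thesis
      using allL wf_rename_tm[OF ar] by (blast intro: cprov.allL)
  next
    case (exR t \<Gamma> B \<Delta>)
    have "cprov L S (insert (inst (rename_fm \<rho> B) (map_tm \<rho> t)) T)"
      using em exR by (intro IH[OF _ ar]) (auto simp: embeds_simps embeds_insert rename_subst_fm)
    moreover have "Ex (rename_fm \<rho> B) \<in> T"
      using em exR by (auto simp: embeds_simps)
    ultimately show ?thesis
      using exR wf_rename_tm[OF ar] by (blast intro: cprov.exR)
  next
    case (exL c B \<Gamma> \<Delta>)
    have "Ex (rename_fm \<rho> B) \<in> S"
      using em exL by (auto simp: embeds_simps)
    moreover have "cprov L (insert (inst (rename_fm \<rho> B) (Const c')) S) T"
      if "c' \<in> constants L" for c'
    proof -
      \<comment> \<open>The one premise about \<open>c\<close> serves every \<open>c'\<close>: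
        redirecting \<open>c\<close> to \<open>c'\<close> leaves the embedding of the lower sequent
        intact.\<close>
      define \<rho>' where "\<rho>' = \<rho>(c := c')"
      have B: "rename_fm \<rho>' (inst B (Const c)) = inst (rename_fm \<rho> B) (Const c')"
        unfolding \<rho>'_def using exL(5) by (intro rename_inst_fresh) simp
      have "embeds \<rho>' s S T"
        unfolding \<rho>'_def using em exL by (subst embeds_upd_fresh) auto
      moreover have "arity_preserving L \<rho>'"
        unfolding \<rho>'_def using ar exL(4) that by (rule arity_preserving_upd)
      ultimately show ?thesis
        using exL B by (intro IH[of _ \<rho>']) (auto simp: embeds_simps embeds_insert)
    qed
    ultimately show ?thesis by (blast intro: cprov.exL)
  next
    case (allR c \<Gamma> B \<Delta>)
    have "All (rename_fm \<rho> B) \<in> T"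
      using em allR by (auto simp: embeds_simps)
    moreover have "cprov L S (insert (inst (rename_fm \<rho> B) (Const c')) T)"
      if "c' \<in> constants L" for c'
    proof -
      define \<rho>' where "\<rho>' = \<rho>(c := c')"
      have B: "rename_fm \<rho>' (inst B (Const c)) = inst (rename_fm \<rho> B) (Const c')"
        unfolding \<rho>'_def using allR(5) by (intro rename_inst_fresh) simp
      have "embeds \<rho>' s S T"
        unfolding \<rho>'_def using em allR by (subst embeds_upd_fresh) auto
      moreover have "arity_preserving L \<rho>'"
        unfolding \<rho>'_def using ar allR(4) that by (rule arity_preserving_upd)
      ultimately show ?thesis
        using allR B by (intro IH[of _ \<rho>']) (auto simp: embeds_simps embeds_insert)
    qed
    ultimately show ?thesis by (blast intro: cprov.allR)
  qed
qed

section \<open>Return from the set calculus to sequent derivations\<close>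

definition C_derivable :: "('f, 'p) language \<Rightarrow> ('f, 'p) sequent \<Rightarrow> bool" where
  "C_derivable L s \<longleftrightarrow> (\<exists>d. C_proof L d \<and> endseq d = s)"

lemma C_derivable_axiom: "is_axiom s \<Longrightarrow> C_derivable L s"
  unfolding C_derivable_def by (rule exI[of _ "Leaf s"]) (simp add: C_proof_def)

lemma C_derivable_inference:
  assumes "inference L r us s" and "\<forall>u \<in> set us. C_derivable L u"
  shows "C_derivable L s"
proof -
  obtain f where f: "\<forall>u \<in> set us. C_proof L (f u) \<and> endseq (f u) = u"
    using assms(2) unfolding C_derivable_def by metis
  then have "map endseq (map f us) = us"
    by (simp add: map_idI)
  then have "C_proof L (Infer r (map f us) s)"
    using f assms(1) by (auto simp: C_proof_def)
  then show ?thesis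
    unfolding C_derivable_def by (metis endseq.simps(2))
qed

lemma C_derivable_contrL:
  assumes "B \<in># \<Gamma>" and "C_derivable L (add_mset B \<Gamma> \<turnstile> \<Delta>)"
  shows "C_derivable L (\<Gamma> \<turnstile> \<Delta>)"
proof -
  obtain \<Gamma>' where "\<Gamma> = add_mset B \<Gamma>'"
    using assms(1) by (blast dest: multi_member_split)
  then show ?thesis
    using assms(2) by (auto intro: C_derivable_inference[OF inference.contrL])
qed

lemma C_derivable_contrR:
  assumes "B \<in># \<Delta>" and "C_derivable L (\<Gamma> \<turnstile> add_mset B \<Delta>)"
  shows "C_derivable L (\<Gamma> \<turnstile> \<Delta>)"
proof -
  obtain \<Delta>' where "\<Delta> = add_mset B \<Delta>'"
    using assms(1) by (blast dest: multi_member_split)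
  then show ?thesis
    using assms(2) by (auto intro: C_derivable_inference[OF inference.contrR])
qed

text \<open>Meant for the rule for implication on the left, which adds up the succedents of its
  premises.\<close>

lemma C_derivable_contrR_all:
  assumes "set_mset \<Theta> \<subseteq> set_mset \<Delta>" and "C_derivable L (\<Gamma> \<turnstile> \<Delta> + \<Theta>)"
  shows "C_derivable L (\<Gamma> \<turnstile> \<Delta>)"
  using assms
proof (induction \<Theta>)
  case (add B \<Theta>)
  then have "C_derivable L (\<Gamma> \<turnstile> \<Delta> + \<Theta>)"
    by (intro C_derivable_contrR[of B "\<Delta> + \<Theta>"]) auto
  then show ?case using add by simp
qed simp

text \<open>The multisets are arbitrary with the given supports, since contraction makes
  multiplicities irrelevant. A rule that consumes its principal formula is applied to an extra copy,
  which is then contracted with the persistent one.\<close>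

lemma cprov_imp_C_derivable:
  assumes "infinite (constants L)" and "cprov L (set_mset \<Gamma>) (set_mset \<Delta>)"
  shows "C_derivable L (\<Gamma> \<turnstile> \<Delta>)"
  using assms(2)
proof (induction "set_mset \<Gamma>" "set_mset \<Delta>" arbitrary: \<Gamma> \<Delta> rule: cprov.induct)
  case top
  then show ?case by (auto intro: C_derivable_axiom)
next
  case (ax A)
  then show ?case by (intro C_derivable_axiom) auto
next
  case (botR D)
  have "C_derivable L (\<Gamma> \<turnstile> add_mset Bot \<Delta>)"
    by (rule botR.hyps) simp_all
  then have "C_derivable L (\<Gamma> \<turnstile> add_mset D \<Delta>)"
    by (auto intro: C_derivable_inference[OF inference.botR])
  with botR.hyps(1) show ?case by (rule C_derivable_contrR)
next
  case (conL B D)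
  have "C_derivable L (add_mset B (add_mset D \<Gamma>) \<turnstile> \<Delta>)"
    by (rule conL.hyps) simp_all
  \<comment> \<open>The rule for conjunction on the left keeps its principal formula, so no
    contraction follows.\<close>
  moreover obtain \<Gamma>' where "\<Gamma> = add_mset (Con B D) \<Gamma>'"
    using conL.hyps(1) by (blast dest: multi_member_split)
  ultimately show ?case by (auto intro: C_derivable_inference[OF inference.conL])
next
  case (conR B D)
  have "C_derivable L (\<Gamma> \<turnstile> add_mset B \<Delta>)" "C_derivable L (\<Gamma> \<turnstile> add_mset D \<Delta>)"
    by (rule conR.hyps; simp)+
  then have "C_derivable L (\<Gamma> \<turnstile> add_mset (Con B D) \<Delta>)"
    by (auto intro: C_derivable_inference[OF inference.conR])
  with conR.hyps(1) show ?case by (rule C_derivable_contrR)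
next
  case (disL B D)
  have "C_derivable L (add_mset B \<Gamma> \<turnstile> \<Delta>)" "C_derivable L (add_mset D \<Gamma> \<turnstile> \<Delta>)"
    by (rule disL.hyps; simp)+
  then have "C_derivable L (add_mset (Dis B D) \<Gamma> \<turnstile> \<Delta>)"
    by (auto intro: C_derivable_inference[OF inference.disL])
  with disL.hyps(1) show ?case by (rule C_derivable_contrL)
next
  case (disR1 B D)
  have "C_derivable L (\<Gamma> \<turnstile> add_mset B \<Delta>)"
    by (rule disR1.hyps) simp_all
  then have "C_derivable L (\<Gamma> \<turnstile> add_mset (Dis B D) \<Delta>)"
    by (auto intro: C_derivable_inference[OF inference.disR1])
  with disR1.hyps(1) show ?case by (rule C_derivable_contrR)
next
  case (disR2 B D)
  have "C_derivable L (\<Gamma> \<turnstile> add_mset D \<Delta>)"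
    by (rule disR2.hyps) simp_all
  then have "C_derivable L (\<Gamma> \<turnstile> add_mset (Dis B D) \<Delta>)"
    by (auto intro: C_derivable_inference[OF inference.disR2])
  with disR2.hyps(1) show ?case by (rule C_derivable_contrR)
next
  case (impL B D)
  \<comment> \<open>The additional copy of the implication does not change the support.\<close>
  have "C_derivable L (add_mset (Imp B D) \<Gamma> \<turnstile> add_mset B \<Delta>)"
    using impL.hyps(1) by (intro impL.hyps(3)) auto
  moreover have "C_derivable L (add_mset D \<Gamma> \<turnstile> \<Delta>)"
    by (rule impL.hyps) simp_all
  ultimately have "C_derivable L (add_mset (Imp B D) \<Gamma> \<turnstile> \<Delta> + \<Delta>)"
    by (auto intro: C_derivable_inference[OF inference.impL])
  then have "C_derivable L (add_mset (Imp B D) \<Gamma> \<turnstile> \<Delta>)"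
    by (rule C_derivable_contrR_all[rotated]) simp
  with impL.hyps(1) show ?case by (rule C_derivable_contrL)
next
  case (impR B D)
  have "C_derivable L (add_mset B \<Gamma> \<turnstile> add_mset D \<Delta>)"
    by (rule impR.hyps) simp_all
  then have "C_derivable L (\<Gamma> \<turnstile> add_mset (Imp B D) \<Delta>)"
    by (auto intro: C_derivable_inference[OF inference.impR])
  with impR.hyps(1) show ?case by (rule C_derivable_contrR)
next
  case (allL B t)
  have "C_derivable L (add_mset (inst B t) \<Gamma> \<turnstile> \<Delta>)"
    by (rule allL.hyps) simp_all
  moreover obtain \<Gamma>' where "\<Gamma> = add_mset (All B) \<Gamma>'"
    using allL.hyps(1) by (blast dest: multi_member_split)
  ultimately show ?case
    using allL.hyps(2) by (auto intro: C_derivable_inference[OF inference.allL])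
next
  case (exR B t)
  have "C_derivable L (\<Gamma> \<turnstile> add_mset (inst B t) \<Delta>)"
    by (rule exR.hyps) simp_all
  then have "C_derivable L (\<Gamma> \<turnstile> add_mset (Ex B) \<Delta>)"
    using exR.hyps(2) by (auto intro: C_derivable_inference[OF inference.exR])
  with exR.hyps(1) show ?case by (rule C_derivable_contrR)
next
  case (exL B)
  \<comment> \<open>Of the premises for all constants, only one for a fresh constant is
    kept.\<close>
  obtain c where c: "c \<in> constants L" "c \<notin> fun_syms_seq (add_mset (Ex B) \<Gamma> \<turnstile> \<Delta>)"
    using fresh_constant[OF assms(1)] .
  have "C_derivable L (add_mset (inst B (Const c)) \<Gamma> \<turnstile> \<Delta>)"
    by (rule exL.hyps(3)[OF c(1)]) simp_all
  then have "C_derivable L (add_mset (Ex B) \<Gamma> \<turnstile> \<Delta>)"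
    by (auto intro: C_derivable_inference[OF inference.exL[OF c]])
  with exL.hyps(1) show ?case by (rule C_derivable_contrL)
next
  case (allR B)
  obtain c where c: "c \<in> constants L" "c \<notin> fun_syms_seq (\<Gamma> \<turnstile> add_mset (All B) \<Delta>)"
    using fresh_constant[OF assms(1)] .
  have "C_derivable L (\<Gamma> \<turnstile> add_mset (inst B (Const c)) \<Delta>)"
    by (rule allR.hyps(3)[OF c(1)]) simp_all
  then have "C_derivable L (\<Gamma> \<turnstile> add_mset (All B) \<Delta>)"
    by (auto intro: C_derivable_inference[OF inference.allR[OF c]])
  with allR.hyps(1) show ?case by (rule C_derivable_contrR)
qed

section \<open>A uniform calculus on sets\<close>

text \<open>Left rules are needed for the goal \<open>\<bottom>\<close> only.\<close>

inductive uprov :: "('f, 'p) language \<Rightarrow> ('f, 'p) fm set \<Rightarrow> ('f, 'p) fm \<Rightarrow> bool"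
  for L :: "('f, 'p) language" where
  top: "uprov L W Top"
| ax: "A \<in> W \<Longrightarrow> A = Bot \<or> (\<exists>p ts. A = Atom p ts) \<Longrightarrow> uprov L W A"
| botR: "uprov L W Bot \<Longrightarrow> uprov L W (Atom p ts)"
| conR: "uprov L W B \<Longrightarrow> uprov L W D \<Longrightarrow> uprov L W (Con B D)"
| disR1: "uprov L W B \<Longrightarrow> uprov L W (Dis B D)"
| disR2: "uprov L W D \<Longrightarrow> uprov L W (Dis B D)"
| impR: "uprov L (insert B W) D \<Longrightarrow> uprov L W (Imp B D)"
| exR: "wf_tm L t \<Longrightarrow> uprov L W (inst B t) \<Longrightarrow> uprov L W (Ex B)"
| conL: "Con B D \<in> W \<Longrightarrow> uprov L (insert B (insert D W)) Bot \<Longrightarrow> uprov L W Bot"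
| disL: "Dis B D \<in> W \<Longrightarrow> uprov L (insert B W) Bot \<Longrightarrow> uprov L (insert D W) Bot \<Longrightarrow> uprov L W Bot"
| impL: "Imp B D \<in> W \<Longrightarrow> uprov L W B \<Longrightarrow> uprov L (insert D W) Bot \<Longrightarrow> uprov L W Bot"
| allL: "All B \<in> W \<Longrightarrow> wf_tm L t \<Longrightarrow> uprov L (insert (inst B t) W) Bot \<Longrightarrow> uprov L W Bot"
| exL: "Ex B \<in> W \<Longrightarrow> (\<And>c. c \<in> constants L \<Longrightarrow> uprov L (insert (inst B (Const c)) W) Bot) \<Longrightarrow>
    uprov L W Bot"

text \<open>Persistence in the Kripke model. No freshness condition obstructs it, because
  \<open>exL\<close> has a premise for every constant.\<close>

lemma uprov_mono: "uprov L W H \<Longrightarrow> W \<subseteq> W' \<Longrightarrow> uprov L W' H"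
proof (induction arbitrary: W' rule: uprov.induct)
  case (conL B D W)
  then show ?case by (meson insert_mono subsetD uprov.conL)
next
  case (disL B D W)
  then show ?case by (meson insert_mono subsetD uprov.disL)
next
  case (impL B D W)
  then show ?case by (meson insert_mono subsetD uprov.impL)
next
  case (allL B W t)
  then show ?case by (meson insert_mono subsetD uprov.allL)
next
  case (exL B W)
  then show ?case by (meson insert_mono subsetD uprov.exL)
next
  case (impR B W D)
  then show ?case by (meson insert_mono uprov.impR)
qed (auto intro: uprov.intros)

text \<open>Unlike \<open>size\<close>, this measure is invariant under substitution, as it ignores terms.\<close>

primrec rank :: "('f, 'p) fm \<Rightarrow> nat" where
  "rank Top = 0"
| "rank Bot = 0"
| "rank (Atom p ts) = 0"
| "rank (Con B D) = Suc (rank B + rank D)"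
| "rank (Dis B D) = Suc (rank B + rank D)"
| "rank (Imp B D) = Suc (rank B + rank D)"
| "rank (Ex B) = Suc (rank B)"
| "rank (All B) = Suc (rank B)"

lemma rank_subst_fm: "rank (subst_fm k t B) = rank B"
  by (induction B arbitrary: k t) auto

inductive_cases G_formulaE:
  "G_formula (Con B D)" "G_formula (Dis B D)" "G_formula (Imp B D)" "G_formula (Ex B)"
  "G_formula (All B)"

inductive_cases D_formulaE:
  "D_formula (Con B D)" "D_formula (Dis B D)" "D_formula (Imp B D)" "D_formula (Ex B)"
  "D_formula (All B)"

text \<open>Both classes are treated at once, because implication interchanges them on its
  left.\<close>

lemma GD_formula_subst:
  "(G_formula B \<longrightarrow> G_formula (subst_fm k t B)) \<and> (D_formula B \<longrightarrow> D_formula (subst_fm k t B))"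
  by (induction B arbitrary: k t)
    (auto elim!: G_formulaE D_formulaE intro: G_formula_D_formula.intros)

lemmas G_formula_subst = GD_formula_subst[THEN conjunct1, rule_format]
  and D_formula_subst = GD_formula_subst[THEN conjunct2, rule_format]

text \<open>The rule \<open>botR\<close> covers atoms only. No universal quantifier stands in goal
  position in a \<open>G_formula\<close>, so the right rules reduce it to atoms, \<open>Top\<close>
  and \<open>Bot\<close>. The induction is on \<open>rank\<close> because an instance of
  \<open>B\<close> is not a subformula of \<open>Ex B\<close>.\<close>

lemma uprov_ex_falso: "G_formula H \<Longrightarrow> uprov L W Bot \<Longrightarrow> uprov L W H"
proof (induction "rank H" arbitrary: H W rule: less_induct)
  case less
  from less.prems(1) show ?case
  proof (cases rule: G_formula.cases)
    case (6 B C)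
    have "uprov L (insert B W) C"
      by (rule less.hyps) (use 6 less.prems(2) in \<open>auto intro: uprov_mono\<close>)
    then show ?thesis using 6 by (auto intro: uprov.impR)
  next
    case (7 B)
    \<comment> \<open>Any term can serve as witness; \<open>Var 0\<close> is always
      well-formed.\<close>
    have "uprov L W (inst B (Var 0))"
      by (rule less.hyps) (use 7 less.prems(2) in \<open>auto simp: rank_subst_fm intro: G_formula_subst\<close>)
    then show ?thesis using 7 by (auto intro: uprov.exR[of L "Var 0"])
  qed (use less in \<open>auto intro: uprov.intros\<close>)
qed

section \<open>Kripke refutation and classical proofs\<close>

text \<open>Intuitionistic negation in a Kripke model whose worlds may be inconsistent. Ranging over
  larger worlds makes it persistent.\<close>

definition refuted :: "('f, 'p) language \<Rightarrow> ('f, 'p) fm set \<Rightarrow> ('f, 'p) fm \<Rightarrow> bool" where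
  "refuted L W H \<longleftrightarrow> (\<forall>W'. W \<subseteq> W' \<longrightarrow> uprov L W' H \<longrightarrow> uprov L W' Bot)"

lemma refutedD: "refuted L W H \<Longrightarrow> uprov L W H \<Longrightarrow> uprov L W Bot"
  by (auto simp: refuted_def)

lemma refuted_mono: "refuted L W H \<Longrightarrow> W \<subseteq> W' \<Longrightarrow> refuted L W' H"
  by (auto simp: refuted_def)

text \<open>The world \<open>W\<close> is separate from \<open>S\<close> so that induction
  hypotheses apply at larger worlds. Right rules pass refutation from the principal formula to the
  premises; left rules are matched by those of \<open>uprov\<close>.\<close>

lemma cprov_imp_uprov_Bot:
  assumes "cprov L S T" and "\<forall>D \<in> S. D_formula D" and "\<forall>H \<in> T. G_formula H"
    and "S \<subseteq> W" and "\<forall>H \<in> T. refuted L W H"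
  shows "uprov L W Bot"
  using assms
proof (induction arbitrary: W rule: cprov.induct)
  case (top T S)
  then show ?case by (blast intro: uprov.top refutedD)
next
  case (ax A S T)
  then show ?case by (blast intro: uprov.ax refutedD)
next
  case (botR D T S)
  \<comment> \<open>\<open>Bot\<close> is refuted in every world.\<close>
  then show ?case
    by (intro botR.IH) (auto simp: refuted_def intro: G_formula_D_formula.intros)
next
  case (conL B D S T)
  then have "D_formula B" "D_formula D"
    by (auto elim: D_formulaE)
  then have "uprov L (insert B (insert D W)) Bot"
    using conL.prems by (intro conL.IH) (auto intro: refuted_mono)
  then show ?case
    using conL by (blast intro: uprov.conL)
next
  case (conR B D T S)
  then have G: "G_formula B" "G_formula D"
    by (auto elim: G_formulaE)
  \<comment> \<open>A world above \<open>W\<close> that proves \<open>B\<close> refutes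
    \<open>D\<close>, since a still larger one proving \<open>D\<close> proves the refuted
    conjunction. The hypothesis for \<open>D\<close> then applies there.\<close>
  have "refuted L W B"
    unfolding refuted_def
  proof (intro allI impI)
    fix W' assume W': "W \<subseteq> W'" "uprov L W' B"
    have "refuted L W' D"
      unfolding refuted_def
    proof (intro allI impI)
      fix W'' assume W'': "W' \<subseteq> W''" "uprov L W'' D"
      then have "uprov L W'' (Con B D)"
        using W' by (blast intro: uprov.conR uprov_mono)
      then show "uprov L W'' Bot"
        using conR.hyps(1) conR.prems(4) W' W'' by (blast intro: refutedD refuted_mono)
    qed
    then show "uprov L W' Bot"
      using conR.prems W' G by (intro conR.IH(2)) (auto intro: refuted_mono)
  qed
  then show ?case
    using conR.prems G by (intro conR.IH(1)) auto
next
  case (disL B D S T)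
  then have "D_formula B" "D_formula D"
    by (auto elim: D_formulaE)
  then have "uprov L (insert B W) Bot" "uprov L (insert D W) Bot"
    using disL.prems by (intro disL.IH; auto intro: refuted_mono)+
  then show ?case
    using disL by (blast intro: uprov.disL)
next
  case (disR1 B D T S)
  then have "G_formula B"
    by (auto elim: G_formulaE)
  moreover have "refuted L W B"
    using disR1.hyps(1) disR1.prems(4) unfolding refuted_def by (blast intro: uprov.disR1)
  ultimately show ?case
    using disR1.prems by (intro disR1.IH) auto
next
  case (disR2 B D T S)
  then have "G_formula D"
    by (auto elim: G_formulaE)
  moreover have "refuted L W D"
    using disR2.hyps(1) disR2.prems(4) unfolding refuted_def by (blast intro: uprov.disR2)
  ultimately show ?case
    using disR2.prems by (intro disR2.IH) auto
next
  case (impL B D S T)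
  then have GD: "G_formula B" "D_formula D" "Imp B D \<in> W"
    by (auto elim: D_formulaE)
  have D: "uprov L (insert D W) Bot"
    using impL.prems GD by (intro impL.IH(2)) (auto intro: refuted_mono)
  \<comment> \<open>Where \<open>B\<close> is provable, \<open>impL\<close> closes with the
    \<open>Bot\<close> already derived from \<open>D\<close>.\<close>
  have "refuted L W B"
    unfolding refuted_def
  proof (intro allI impI)
    fix W' assume W': "W \<subseteq> W'" "uprov L W' B"
    have "uprov L (insert D W') Bot"
      using D W' by (blast intro: uprov_mono)
    then show "uprov L W' Bot"
      using GD W' by (blast intro: uprov.impL)
  qed
  then show ?case
    using impL.prems GD by (intro impL.IH(1)) auto
next
  case (impR B D T S)
  then have GD: "D_formula B" "G_formula D"
    by (auto elim: G_formulaE)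
  \<comment> \<open>Larger worlds contain \<open>B\<close>, so a proof of \<open>D\<close> there
    gives the implication at the same world.\<close>
  have "refuted L (insert B W) D"
    unfolding refuted_def
  proof (intro allI impI)
    fix W' assume W': "insert B W \<subseteq> W'" "uprov L W' D"
    then have "uprov L W' (Imp B D)"
      by (auto simp: insert_absorb intro: uprov.impR)
    then show "uprov L W' Bot"
      using impR.hyps(1) impR.prems(4) W' by (blast intro: refutedD refuted_mono)
  qed
  then have "uprov L (insert B W) Bot"
    using impR.prems GD by (intro impR.IH) (auto intro: refuted_mono)
  \<comment> \<open>Ex falso enters here: having \<open>Bot\<close>, the world with \<open>B\<close>
    proves \<open>D\<close>, so \<open>W\<close> proves the implication that it refutes.\<close>
  then have "uprov L W (Imp B D)"
    using GD by (blast intro: uprov.impR uprov_ex_falso)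
  then show ?case
    using impR by (blast intro: refutedD)
next
  case (allL B S t T)
  then have "D_formula (All B)" by blast
  then have "D_formula (inst B t)"
    by (auto elim: D_formulaE intro: D_formula_subst)
  then have "uprov L (insert (inst B t) W) Bot"
    using allL.prems by (intro allL.IH) (auto intro: refuted_mono)
  then show ?case
    using allL by (blast intro: uprov.allL)
next
  case (exR B T t S)
  then have "G_formula (Ex B)" by blast
  then have "G_formula (inst B t)"
    by (auto elim: G_formulaE intro: G_formula_subst)
  moreover have "refuted L W (inst B t)"
    using exR.hyps(1,2) exR.prems(4) unfolding refuted_def by (blast intro: uprov.exR)
  ultimately show ?case
    using exR.prems by (intro exR.IH) auto
next
  case (exL B S T)
  have "uprov L (insert (inst B (Const c)) W) Bot" if "c \<in> constants L" for c
  proof -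
    have "D_formula (Ex B)" using exL by blast
    then have "D_formula (inst B (Const c))"
      by (auto elim: D_formulaE intro: D_formula_subst)
    then show ?thesis
      using exL.prems by (intro exL.IH[OF that]) (auto intro: refuted_mono)
  qed
  then show ?case
    using exL by (blast intro: uprov.exL)
next
  case (allR B T S)
  \<comment> \<open>A goal cannot be universally quantified.\<close>
  then show ?case by (auto elim: G_formulaE)
qed

section \<open>From the uniform set calculus to uniform proofs\<close>

lemma O_provable_axiom:
  assumes "is_axiom (\<Gamma> \<turnstile> {#B#})" and "right_rule B = None"
  shows "O_provable L \<Gamma> B"
  unfolding O_provable_def using assms
  by (intro exI[of _ "Leaf (\<Gamma> \<turnstile> {#B#})"])
    (auto simp: uniform_proof_def I_proof_def C_proof_def uniform_root_def)

text \<open>Single succedents in all premises give an I-proof; the last assumption is uniformity at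
  the new root.\<close>

lemma O_provable_inference:
  assumes "inference L r us (\<Gamma> \<turnstile> {#B#})"
    and "\<forall>u \<in> set us. \<exists>\<Gamma>' B'. u = (\<Gamma>' \<turnstile> {#B'#}) \<and> O_provable L \<Gamma>' B'"
    and "right_rule B = None \<or> right_rule B = Some r"
  shows "O_provable L \<Gamma> B"
proof -
  have "\<forall>u \<in> set us. \<exists>d. uniform_proof L d \<and> endseq d = u"
    using assms(2) unfolding O_provable_def by fast
  then obtain f where f: "\<forall>u \<in> set us. uniform_proof L (f u) \<and> endseq (f u) = u"
    by metis
  then have "map endseq (map f us) = us"
    by (simp add: map_idI)
  then have "uniform_proof L (Infer r (map f us) (\<Gamma> \<turnstile> {#B#}))"
    using f assms(1,3)
    by (auto simp: uniform_proof_def I_proof_def C_proof_def uniform_root_def)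
  then show ?thesis
    unfolding O_provable_def by (metis endseq.simps(2))
qed

text \<open>Contraction with succedent \<open>Bot\<close> is uniform, because \<open>Bot\<close> has
  no right rule.\<close>

lemma O_provable_contrL:
  assumes "B \<in># \<Gamma>" and "O_provable L (add_mset B \<Gamma>) Bot"
  shows "O_provable L \<Gamma> Bot"
proof -
  obtain \<Gamma>' where "\<Gamma> = add_mset B \<Gamma>'"
    using assms(1) by (blast dest: multi_member_split)
  then show ?thesis
    using assms(2) by (auto intro: O_provable_inference[OF inference.contrL])
qed

text \<open>Left rules and contraction end in \<open>Bot\<close>, and \<open>botR\<close> in atoms,
  where uniformity prescribes no rule; compound goals end in their own right rule.\<close>

lemma uprov_imp_O_provable:
  assumes "infinite (constants L)" and "uprov L (set_mset \<Gamma>) H"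
  shows "O_provable L \<Gamma> H"
  using assms(2)
proof (induction "set_mset \<Gamma>" H arbitrary: \<Gamma> rule: uprov.induct)
  case top
  then show ?case by (auto intro: O_provable_axiom)
next
  case (ax A)
  then show ?case by (intro O_provable_axiom) auto
next
  case (botR p ts)
  then show ?case by (auto intro: O_provable_inference[OF inference.botR])
next
  case (conR B D)
  have "O_provable L \<Gamma> B" "O_provable L \<Gamma> D"
    by (rule conR.hyps; simp)+
  then show ?case by (intro O_provable_inference[OF inference.conR]) auto
next
  case (disR1 B D)
  have "O_provable L \<Gamma> B"
    by (rule disR1.hyps; simp)+
  then show ?case by (intro O_provable_inference[OF inference.disR1]) auto
next
  case (disR2 D B)
  have "O_provable L \<Gamma> D"
    by (rule disR2.hyps; simp)+
  then show ?case by (intro O_provable_inference[OF inference.disR2]) auto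
next
  case (impR B D)
  then have "O_provable L (add_mset B \<Gamma>) D" by simp
  then show ?case by (intro O_provable_inference[OF inference.impR]) auto
next
  case (exR t B)
  have "O_provable L \<Gamma> (inst B t)"
    by (rule exR.hyps; simp)+
  then show ?case by (intro O_provable_inference[OF inference.exR[OF exR.hyps(1)]]) auto
next
  case (conL B D)
  have "O_provable L (add_mset B (add_mset D \<Gamma>)) Bot"
    by (rule conL.hyps) simp
  moreover obtain \<Gamma>' where "\<Gamma> = add_mset (Con B D) \<Gamma>'"
    using conL.hyps(1) by (blast dest: multi_member_split)
  ultimately show ?case by (auto intro: O_provable_inference[OF inference.conL])
next
  case (disL B D)
  have "O_provable L (add_mset B \<Gamma>) Bot" "O_provable L (add_mset D \<Gamma>) Bot"
    by (rule disL.hyps; simp)+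
  then have "O_provable L (add_mset (Dis B D) \<Gamma>) Bot"
    by (intro O_provable_inference[OF inference.disL]) auto
  with disL.hyps(1) show ?case by (rule O_provable_contrL)
next
  case (impL B D)
  have "O_provable L (add_mset (Imp B D) \<Gamma>) B"
    using impL.hyps(1) by (intro impL.hyps(3)) auto
  moreover have "O_provable L (add_mset D \<Gamma>) Bot"
    by (rule impL.hyps) simp
  \<comment> \<open>With the succedent split as \<open>{#}\<close> and \<open>{#Bot#}\<close>, the
    left premise has only \<open>B\<close> on the right.\<close>
  ultimately have "O_provable L (add_mset (Imp B D) \<Gamma>) Bot"
    using inference.impL[of L B D \<Gamma> "{#}" "{#Bot#}"]
    by (intro O_provable_inference[of L ImpL]) auto
  with impL.hyps(1) show ?case by (rule O_provable_contrL)
next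
  case (allL B t)
  have "O_provable L (add_mset (inst B t) \<Gamma>) Bot"
    by (rule allL.hyps) simp
  moreover obtain \<Gamma>' where "\<Gamma> = add_mset (All B) \<Gamma>'"
    using allL.hyps(1) by (blast dest: multi_member_split)
  ultimately show ?case
    using allL.hyps(2) by (auto intro: O_provable_inference[OF inference.allL])
next
  case (exL B)
  obtain c where c: "c \<in> constants L" "c \<notin> fun_syms_seq (add_mset (Ex B) \<Gamma> \<turnstile> {#Bot#})"
    using fresh_constant[OF assms(1)] .
  have "O_provable L (add_mset (inst B (Const c)) \<Gamma>) Bot"
    by (rule exL.hyps(3)[OF c(1)]) simp
  then have "O_provable L (add_mset (Ex B) \<Gamma>) Bot"
    by (auto intro: O_provable_inference[OF inference.exL[OF c]])
  with exL.hyps(1) show ?case by (rule O_provable_contrL)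
qed

theorem theorem3:
  fixes L :: "('f, 'p) language"
    and G :: "('f, 'p) fm"
    and \<Gamma> :: "('f, 'p) fm multiset"
  assumes "infinite (constants L)"
    and "wf_fm L G" and "G_formula G"
    and "\<forall>D \<in># \<Gamma>. wf_fm L D \<and> D_formula D"
  shows "C_provable L \<Gamma> G \<longleftrightarrow> O_provable L (add_mset (Imp G Bot) \<Gamma>) G"
proof
  have id: "arity_preserving L id"
    by (simp add: arity_preserving_def)
  {
    assume "C_provable L \<Gamma> G"
    then obtain d where d: "C_proof L d" "endseq d = (\<Gamma> \<turnstile> {#G#})"
      by (auto simp: C_provable_def)
    have "embeds id (endseq d) (set_mset \<Gamma>) {G}"
      using d(2) by (simp add: embeds_def fm.map_id)
    with d(1) id have cprov: "cprov L (set_mset \<Gamma>) {G}"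
      by (rule C_proof_imp_cprov)
    let ?W = "set_mset (add_mset (Imp G Bot) \<Gamma>)"
    \<comment> \<open>\<open>impL\<close> on \<open>Imp G Bot\<close> turns a proof of
      \<open>G\<close> into one of \<open>Bot\<close>; its other premise is an axiom.\<close>
    have "refuted L ?W G"
      by (auto simp: refuted_def intro: uprov.impL uprov.ax)
    then have "uprov L ?W Bot"
      using assms(3,4) by (intro cprov_imp_uprov_Bot[OF cprov]) auto
    then show "O_provable L (add_mset (Imp G Bot) \<Gamma>) G"
      using assms(1,3) by (blast intro: uprov_imp_O_provable[OF _ uprov_ex_falso])
  next
    assume "O_provable L (add_mset (Imp G Bot) \<Gamma>) G"
    then obtain d where d: "C_proof L d" "endseq d = (add_mset (Imp G Bot) \<Gamma> \<turnstile> {#G#})"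
      by (auto simp: O_provable_def uniform_proof_def I_proof_def)
    \<comment> \<open>\<open>G\<close> lies in the succedent, so its negation may be omitted from
      the antecedent.\<close>
    have "embeds id (endseq d) (set_mset \<Gamma>) {G}"
      using d(2) by (simp add: embeds_def fm.map_id)
    with d(1) id have "cprov L (set_mset \<Gamma>) {G}"
      by (rule C_proof_imp_cprov)
    then show "C_provable L \<Gamma> G"
      using cprov_imp_C_derivable[OF assms(1), of \<Gamma> "{#G#}"]
      by (simp add: C_derivable_def C_provable_def)
  }
qed

end
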